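(* Let $q\ge 2$ be an odd integer and $k_1$ an integer with $\gcd(k_1,q)=1$ such that the Dekking curve $R=D_{2,q,k_1}$ is regular, with scaling factor $r$. Let $T=(t_2,\tau)$ be a Thue-Morse turtle curve such that $\alpha_T(\phi(0))=\zeta_{2^bq}^{k_2}$, where $\phi$ is the morphism on $(\mathbb Z/2\mathbb Z)^*$ with $\phi(0)=01$, $\phi(1)=10$, and $b,k_2\in\mathbb N$ with $\gcd(k_2,q)=1$. Suppose also that $P_T(\phi(0))\neq P_T(\phi(1))$. If there exists $d\in\mathbb N$ such that $k_1\equiv 2^dk_2\pmod q$, then there is a nontrivial $K\in\mathcal H(\mathbb C)$ which is a limit curve of both $R$ and $T$, and $$\lim_{n\to\infty}r^{-n}\mathcal P(R[:Q^n])=K$$ in the Hausdorff metric, where $Q=2^{\varphi(q)}$.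
   Context: Notation: $\mathbb N=\{0,1,2,\dots\}$; $\mathbb S^1=\{z\in\mathbb C:|z|=1\}$; $\zeta_m=e^{2\pi i/m}$; $\varphi$ is Euler's totient function; $A^*$ is the set of finite words over $A$; $w[j]$ is the letter of the word $w$ at position $j$, starting at $0$; $\Vert$ denotes concatenation. Turtle group: $\mathcal G=\mathbb C\times\mathbb S^1$ with $(z_1,u_1)+(z_2,u_2)=(z_1+u_1z_2,u_1u_2)$ (sums are taken in order from left to right, empty sum $(0,1)$), and projections $\pi_1(z,u)=z$, $\pi_2(z,u)=u$. Turtle curve: a pair $T=(\sigma,\tau)$ where $\sigma:\mathbb N\to A$ is a sequence over a finite alphabet $A$ and $\tau:A\to\mathcal G$ is any function (an interpreter function). It is also viewed as the sequence of points $T(n)=\pi_1\left(\sum_{i=0}^{n-1}\tau(\sigma(i))\right)\in\mathbb C$. For a word $w=a_1\cdots a_m\in A^*$ put $S_T(w)=\tau(a_1)+\cdots+\tau(a_m)$, $P_T(w)=\pi_1(S_T(w))$, $\alpha_T(w)=\pi_2(S_T(w))$. An absolute turtle curve is one with $\pi_2(\tau(a))=1$ for all $a\in A$; then $\tau$ is viewed as a map $A\to\mathbb C$ (a complex number $c$ standing for $(c,1)$). Thue-Morse: for $p\ge2$, $t_p:\mathbb N\to\mathbb Z/p\mathbb Z$ is defined by $t_p(0)=0$ and $t_p(pm+s)=t_p(m)+\overline s$ for $m\in\mathbb N$, $0\le s<p$. A Thue-Morse turtle curve is a turtle curve of the form $(t_p,\tau)$. Dekking curves: for integers $p,q\ge2$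 let $z_{p,q}(n)=(t_p(n),\overline n)\in A_{p,q}=\mathbb Z/p\mathbb Z\times\mathbb Z/q\mathbb Z$. For an integer $k$ with $\gcd(k,q)=1$, the Dekking curve $D_{p,q,k}$ is the absolute turtle curve $(z_{p,q},\tau)$ with $\tau((x,y))=\zeta_p^x\zeta_q^{ky}$. When $\gcd(p,q)=1$, let $Q=p^{\varphi(q)}$; let $\phi_p$ be the morphism on $(\mathbb Z/p\mathbb Z)^*$ with $\phi_p(a)=\Vert_{j=0}^{p-1}(a+\overline j)$, $\mu=\phi_p^{\varphi(q)}$, let $\delta$ be the morphism on $(\mathbb Z/q\mathbb Z)^*$ with $\delta(a)=\Vert_{j=0}^{Q-1}(a+\overline j)$, and let $\lambda$ be the morphism on $A_{p,q}^*$ with $\lambda((x,y))=\Vert_{j=0}^{Q-1}(\mu(x)[j],\delta(y)[j])$. The scaling factor of $D=D_{p,q,k}$ is $r=P_D(\lambda((0,0)))$, and $D$ is regular if (with $\gcd(p,q)=1$) $|r|>1$. Curves and limits: for $x,y\in\mathbb C$ let $\ell(x,y)=\{x+t(y-x):t\in[0,1]\}$. For a turtle curve $T$, $T[:n]$ is the word $T(0)T(1)\cdots T(n-1)$ over $\mathbb C$, and for a word $w$ of length $n$ over $\mathbb C$, $\mathcal P(w)=\bigcup_{i=0}^{n-2}\ell(w[i],w[i+1])$. $\mathcal H(\mathbb C)$ is the set of nonempty compact subsets of $\mathbb C$ with the Hausdorff metric induced by $|x-y|$. $K\in\mathcal H(\mathbb C)$ is a limit curve of $T$ if there exist $\rho,c\in\mathbb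 C^\times$ with $|\rho|>1$ and a sequence $(b_n)$ of natural numbers such that $\lim_{n\to\infty}\rho^{-n}\mathcal P(T[:b_n])=cK$ in the Hausdorff metric (which requires the sets to be nonempty for all sufficiently large $n$). $K$ is nontrivial if $K\ne\{0\}$. *)

theory Defs
  imports "HOL-Analysis.Analysis" "HOL-Number_Theory.Number_Theory"
begin

section \<open>The turtle group\<close>

typedef turtle = "UNIV \<times> sphere 0 1 :: (complex \<times> complex) set"
  by (rule exI [of _ "(0, 1)"]) simp

setup_lifting type_definition_turtle

lift_definition turtle_pos :: "turtle \<Rightarrow> complex" is fst .

lift_definition turtle_dir :: "turtle \<Rightarrow> complex" is snd .

lift_definition turtle_of_complex :: "complex \<Rightarrow> turtle" is "\<lambda>c. (c, 1)"
  by simp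

text \<open>The group is not commutative; \<open>+\<close> is the semidirect product law, so that
  \<^const>\<open>sum_list\<close> adds up the steps of a walk from left to right.\<close>

instantiation turtle :: group_add
begin

lift_definition zero_turtle :: turtle is "(0, 1)"
  by simp

lift_definition plus_turtle :: "turtle \<Rightarrow> turtle \<Rightarrow> turtle" is
  "\<lambda>(z1, u1) (z2, u2). (z1 + u1 * z2, u1 * u2)"
  by (auto simp: norm_mult)

lift_definition uminus_turtle :: "turtle \<Rightarrow> turtle" is
  "\<lambda>(z, u). (- (z / u), inverse u)"
  by (auto simp: norm_inverse)

definition minus_turtle :: "turtle \<Rightarrow> turtle \<Rightarrow> turtle" where
  "minus_turtle a b = a + - b"

instance
proof
  fix a b c :: turtle
  show "a + b + c = a + (b + c)"
    by transfer (auto simp: algebra_simps)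
  show "0 + a = a"
    by transfer auto
  show "a + 0 = a"
    by transfer auto
  show "- a + a = 0"
    by transfer (auto simp: divide_simps)
  show "a + - b = a - b"
    by (simp add: minus_turtle_def)
qed

end

section \<open>Turtle curves\<close>

text \<open>A pair \<open>(\<sigma>, \<tau>)\<close> of a sequence over an alphabet and an interpreter function.
  The alphabet is the type \<open>'a\<close>; the residue classes in \<open>\<int>/m\<int>\<close> are represented by
  \<open>0, \<dots>, m - 1\<close>, and values of \<open>\<tau>\<close> off the range of \<open>\<sigma>\<close> are irrelevant.\<close>

type_synonym 'a turtle_curve = "(nat \<Rightarrow> 'a) \<times> ('a \<Rightarrow> turtle)"

definition turtle_point :: "'a turtle_curve \<Rightarrow> nat \<Rightarrow> complex" where
  "turtle_point T n = turtle_pos (\<Sum>i\<leftarrow>[0..<n]. snd T (fst T i))"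

definition word_sum :: "'a turtle_curve \<Rightarrow> 'a list \<Rightarrow> turtle" where
  "word_sum T w = (\<Sum>a\<leftarrow>w. snd T a)"

definition word_pos :: "'a turtle_curve \<Rightarrow> 'a list \<Rightarrow> complex" where
  "word_pos T w = turtle_pos (word_sum T w)"

definition word_dir :: "'a turtle_curve \<Rightarrow> 'a list \<Rightarrow> complex" where
  "word_dir T w = turtle_dir (word_sum T w)"

definition turtle_prefix :: "'a turtle_curve \<Rightarrow> nat \<Rightarrow> complex list" where
  "turtle_prefix T n = map (turtle_point T) [0..<n]"

definition polyline :: "complex list \<Rightarrow> complex set" where
  "polyline w = (\<Union>i\<in>{i. i + 1 < length w}. closed_segment (w ! i) (w ! (i + 1)))"

section \<open>Limits in the Hausdorff metric\<close>

definition compacts :: "complex set set" where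
  "compacts = {K. compact K \<and> K \<noteq> {}}"

text \<open>The suprema are only meaningful on \<^const>\<open>compacts\<close>; \<open>hausdorff_lim\<close>
  therefore requires membership of the limit and, eventually, of the sequence.\<close>

definition hausdorff_dist :: "complex set \<Rightarrow> complex set \<Rightarrow> real" where
  "hausdorff_dist K L = max (SUP x\<in>K. infdist x L) (SUP y\<in>L. infdist y K)"

definition hausdorff_lim :: "(nat \<Rightarrow> complex set) \<Rightarrow> complex set \<Rightarrow> bool" where
  "hausdorff_lim X K \<longleftrightarrow>
     K \<in> compacts \<and> (\<forall>\<^sub>F n in sequentially. X n \<in> compacts) \<and>
     (\<lambda>n. hausdorff_dist (X n) K) \<longlonglongrightarrow> 0"

definition limit_curve :: "'a turtle_curve \<Rightarrow> complex set \<Rightarrow> bool" where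
  "limit_curve T K \<longleftrightarrow>
     K \<in> compacts \<and>
     (\<exists>\<rho> c :: complex. \<exists>b :: nat \<Rightarrow> nat. \<rho> \<noteq> 0 \<and> c \<noteq> 0 \<and> norm \<rho> > 1 \<and>
        hausdorff_lim (\<lambda>n. (*) (inverse \<rho> ^ n) ` polyline (turtle_prefix T (b n))) ((*) c ` K))"

section \<open>Thue-Morse sequences\<close>

text \<open>The guard \<open>p < 2\<close> only serves termination.\<close>

function thue_morse :: "nat \<Rightarrow> nat \<Rightarrow> nat" where
  "thue_morse p n =
     (if p < 2 \<or> n = 0 then 0 else (thue_morse p (n div p) + n mod p) mod p)"
  by auto
termination
  by (relation "Wellfounded.measure snd") auto

declare thue_morse.simps [simp del]

lemma thue_morse_0: "thue_morse p 0 = 0"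
  by (simp add: thue_morse.simps)

lemma thue_morse_rec:
  assumes "p \<ge> 2" "s < p"
  shows "thue_morse p (p * m + s) = (thue_morse p m + s) mod p"
  using assms by (subst thue_morse.simps) (auto simp: thue_morse_0)

lemma thue_morse_less: "p \<ge> 2 \<Longrightarrow> thue_morse p n < p"
  by (subst thue_morse.simps) auto

section \<open>Dekking curves\<close>

definition root_of_unity :: "nat \<Rightarrow> complex" where
  "root_of_unity m = exp (2 * of_real pi * \<i> / of_nat m)"

definition dekking :: "nat \<Rightarrow> nat \<Rightarrow> int \<Rightarrow> (nat \<times> nat) turtle_curve" where
  "dekking p q k =
     (\<lambda>n. (thue_morse p n, n mod q),
      \<lambda>(x, y). turtle_of_complex (root_of_unity p ^ x * root_of_unity q powi (k * int y)))"

text \<open>The extension of a map on letters to a morphism on words.\<close>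

definition morphism :: "('a \<Rightarrow> 'b list) \<Rightarrow> 'a list \<Rightarrow> 'b list" where
  "morphism f w = concat (map f w)"

definition shift_word :: "nat \<Rightarrow> nat \<Rightarrow> nat \<Rightarrow> nat list" where
  "shift_word m l a = map (\<lambda>j. (a + j) mod m) [0..<l]"

definition phi_morphism :: "nat \<Rightarrow> nat list \<Rightarrow> nat list" where
  "phi_morphism p = morphism (shift_word p p)"

definition block_len :: "nat \<Rightarrow> nat \<Rightarrow> nat" where
  "block_len p q = p ^ totient q"

definition mu_morphism :: "nat \<Rightarrow> nat \<Rightarrow> nat list \<Rightarrow> nat list" where
  "mu_morphism p q = phi_morphism p ^^ totient q"

definition delta_morphism :: "nat \<Rightarrow> nat \<Rightarrow> nat list \<Rightarrow> nat list" where
  "delta_morphism p q = morphism (shift_word q (block_len p q))"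

definition lambda_morphism :: "nat \<Rightarrow> nat \<Rightarrow> (nat \<times> nat) list \<Rightarrow> (nat \<times> nat) list" where
  "lambda_morphism p q =
     morphism (\<lambda>(x, y). map (\<lambda>j. (mu_morphism p q [x] ! j, delta_morphism p q [y] ! j)) [0..<block_len p q])"

definition scaling_factor :: "nat \<Rightarrow> nat \<Rightarrow> int \<Rightarrow> complex" where
  "scaling_factor p q k = word_pos (dekking p q k) (lambda_morphism p q [(0, 0)])"

definition dekking_regular :: "nat \<Rightarrow> nat \<Rightarrow> int \<Rightarrow> bool" where
  "dekking_regular p q k \<longleftrightarrow> coprime p q \<and> norm (scaling_factor p q k) > 1"

lemma phi_morphism_2: "phi_morphism 2 [0] = [0, 1]" "phi_morphism 2 [1] = [1, 0]"
  by (simp_all add: phi_morphism_def morphism_def shift_word_def numeral_2_eq_2)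

end

theory Submission
  imports Defs
begin

text \<open>The points of both curves are governed by the signed sums
  \<open>F w n = (\<Sum>i<n. (-1) ^ t i * w ^ i)\<close>, which satisfy \<open>F w (2 n) = (1 - w) F (w\<^sup>2) n\<close>.
  For \<open>R\<close> one has \<open>R n = F w n\<close> with \<open>w\<close> a \<open>q\<close>-th root of unity, and since \<open>Q \<equiv> 1\<close> modulo \<open>q\<close>,
  \<open>R (Q n) = r R n\<close>. Hence the rescaled vertex sets \<open>{r\<^sup>-\<^sup>n R i | i < Q\<^sup>n}\<close> increase with \<open>n\<close>, and \<open>K\<close>
  is the closure of their union. For \<open>T\<close>, grouping letters in pairs gives
  \<open>T (2 n) = A (\<Sum>i<n. \<alpha> ^ i) + B F \<alpha> n\<close> with \<open>B \<noteq> 0\<close>; the geometric sum is bounded because \<open>\<alpha> \<noteq> 1\<close>,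
  and after \<open>b + d\<close> doublings \<open>\<alpha>\<close> becomes \<open>w\<close>. So \<open>T\<close>, sampled along multiples of \<open>2\<^sup>b\<^sup>+\<^sup>d\<^sup>+\<^sup>1\<close>, is a
  nonzero multiple of \<open>R\<close> up to a bounded error, which rescaling by \<open>r\<^sup>-\<^sup>n\<close> kills.\<close>

section \<open>Hausdorff limits of rescaled polylines\<close>

text \<open>The bound \<open>e\<close> makes both families of distances bounded above, so the real
  suprema are genuine. Nonnegativity depends on this too, which is why it is proved here along with
  the upper bound.\<close>

lemma hausdorff_dist_bound:
  assumes "K \<noteq> {}" "L \<noteq> {}"
    and "\<And>x. x \<in> K \<Longrightarrow> \<exists>y\<in>L. dist x y \<le> e" "\<And>y. y \<in> L \<Longrightarrow> \<exists>x\<in>K. dist x y \<le> e"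
  shows "0 \<le> hausdorff_dist K L" "hausdorff_dist K L \<le> e"
proof -
  have K: "infdist x L \<le> e" if "x \<in> K" for x
    using assms(3)[OF that] by (meson infdist_le order_trans)
  have L: "infdist y K \<le> e" if "y \<in> L" for y
    using assms(4)[OF that] by (metis dist_commute infdist_le order_trans)
  obtain x where x: "x \<in> K"
    using assms(1) by blast
  have "infdist x L \<le> (SUP x\<in>K. infdist x L)"
    using K x by (intro cSUP_upper bdd_aboveI2) auto
  then show "0 \<le> hausdorff_dist K L"
    unfolding hausdorff_dist_def using infdist_nonneg[of x L] by linarith
  show "hausdorff_dist K L \<le> e"
    unfolding hausdorff_dist_def using assms(1,2) K L by (auto intro!: cSUP_least)
qed

lemma compact_polyline: "compact (polyline w)"
proof -
  have "{i. i + 1 < length w} \<subseteq> {..<length w}"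
    by auto
  then have "finite {i. i + 1 < length w}"
    using finite_subset by blast
  then show ?thesis
    unfolding polyline_def by (intro compact_UN) auto
qed

text \<open>A vertex starts its own segment, except the last one, which ends the previous segment. A
  single vertex has an empty polyline, hence \<open>2 \<le> n\<close>.\<close>

lemma vertex_in_polyline:
  assumes "i < n" "2 \<le> n"
  shows "f i \<in> polyline (map f [0..<n])"
proof (cases "i + 1 < n")
  case True
  then have "f i \<in> closed_segment (map f [0..<n] ! i) (map f [0..<n] ! (i + 1))"
    by simp
  then show ?thesis
    unfolding polyline_def using True by (intro UN_I[of i]) auto
next
  case False
  then have "i - 1 + 1 < n" "i - 1 + 1 = i"
    using assms by auto
  then have "f i \<in> closed_segment (map f [0..<n] ! (i - 1)) (map f [0..<n] ! (i - 1 + 1))"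
    by simp
  then show ?thesis
    unfolding polyline_def using \<open>i - 1 + 1 < n\<close> by (intro UN_I[of "i - 1"]; simp)
qed

lemma polyline_near_vertex:
  assumes "x \<in> polyline (map f [0..<n])" and "\<And>i. dist (f i) (f (Suc i)) \<le> D"
  obtains i where "i < n" "dist x (f i) \<le> D"
proof -
  from assms(1) obtain i where i: "i + 1 < n"
      "x \<in> closed_segment (map f [0..<n] ! i) (map f [0..<n] ! (i + 1))"
    unfolding polyline_def by auto
  then have "x \<in> closed_segment (f i) (f (Suc i))"
    by simp
  then have "dist x (f i) \<le> dist (f i) (f (Suc i))"
    by (metis dist_in_closed_segment(1) dist_commute)
  then show ?thesis
    using that[of i] assms(2)[of i] i(1) by linarith
qed

text \<open>Reduces convergence to a comparison of vertices before rescaling. Filling in the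
  segments costs another \<open>D\<close>, and since neither \<open>C\<close> nor \<open>D\<close>
  depends on \<open>n\<close>, rescaling leaves an error \<open>(C + D) / norm \<rho> ^ n\<close>
  that tends to 0.\<close>

lemma hausdorff_lim_rescaled_polyline:
  fixes \<rho> c :: complex
  assumes K: "K \<in> compacts" and \<rho>: "norm \<rho> > 1"
    and b: "eventually (\<lambda>n. 2 \<le> b n) sequentially"
    and D: "\<And>i. dist (f i) (f (Suc i)) \<le> D"
    and near: "\<And>n i. i < b n \<Longrightarrow> \<exists>y\<in>K. dist (f i) (c * \<rho> ^ n * y) \<le> C"
    and dense: "\<And>n y. y \<in> K \<Longrightarrow> \<exists>i<b n. dist (f i) (c * \<rho> ^ n * y) \<le> C"
  shows "hausdorff_lim (\<lambda>n. (*) (inverse \<rho> ^ n) ` polyline (map f [0..<b n])) ((*) c ` K)"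
proof -
  define X where "X = (\<lambda>n. (*) (inverse \<rho> ^ n) ` polyline (map f [0..<b n]))"
  define e where "e = (\<lambda>n. (C + D) * inverse (norm \<rho>) ^ n)"
  have \<rho>0: "\<rho> \<noteq> 0"
    using \<rho> by auto
  have D0: "0 \<le> D"
    using D[of 0] zero_le_dist order_trans by blast
  have scale: "dist (inverse \<rho> ^ n * u) (c * y) = dist u (c * \<rho> ^ n * y) * inverse (norm \<rho>) ^ n"
    for n u y
  proof -
    have "inverse \<rho> ^ n * u - c * y = inverse \<rho> ^ n * (u - c * \<rho> ^ n * y)"
      using \<rho>0 by (simp add: algebra_simps power_inverse)
    then show ?thesis
      by (simp add: dist_norm norm_mult norm_power norm_inverse)
  qed
  have cK: "(*) c ` K \<in> compacts"
    using K unfolding compacts_def by (auto intro!: compact_continuous_image continuous_intros)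
  have X: "X n \<in> compacts" "0 \<le> hausdorff_dist (X n) ((*) c ` K)"
      "hausdorff_dist (X n) ((*) c ` K) \<le> e n" if n: "2 \<le> b n" for n
  proof -
    have ne: "X n \<noteq> {}"
      using vertex_in_polyline[of 0 "b n" f] n unfolding X_def by auto
    then show "X n \<in> compacts"
      unfolding compacts_def X_def
      by (auto intro!: compact_continuous_image continuous_intros compact_polyline)
    have 1: "\<exists>y\<in>(*) c ` K. dist x y \<le> e n" if "x \<in> X n" for x
    proof -
      from that obtain u where u: "u \<in> polyline (map f [0..<b n])" "x = inverse \<rho> ^ n * u"
        unfolding X_def by auto
      from polyline_near_vertex[OF u(1) D] obtain i where i: "i < b n" "dist u (f i) \<le> D" .
      from near[OF i(1)] obtain y where y: "y \<in> K" "dist (f i) (c * \<rho> ^ n * y) \<le> C"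
        by blast
      have "dist u (c * \<rho> ^ n * y) \<le> C + D"
        using i(2) y(2) dist_triangle[of u "c * \<rho> ^ n * y" "f i"] by linarith
      then have "dist x (c * y) \<le> e n"
        unfolding u(2) scale e_def by (rule mult_right_mono) simp
      then show ?thesis
        using y(1) by blast
    qed
    have 2: "\<exists>x\<in>X n. dist x v \<le> e n" if "v \<in> (*) c ` K" for v
    proof -
      from that obtain y where y: "y \<in> K" "v = c * y"
        by auto
      from dense[OF y(1)] obtain i where i: "i < b n" "dist (f i) (c * \<rho> ^ n * y) \<le> C"
        by blast
      then have "dist (inverse \<rho> ^ n * f i) v \<le> e n"
        unfolding y(2) scale e_def using D0 by (intro mult_right_mono) auto
      moreover have "inverse \<rho> ^ n * f i \<in> X n"
        unfolding X_def using vertex_in_polyline[OF i(1) n] by blast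
      ultimately show ?thesis
        by blast
    qed
    have ne': "(*) c ` K \<noteq> {}"
      using cK unfolding compacts_def by auto
    show "0 \<le> hausdorff_dist (X n) ((*) c ` K)"
      using hausdorff_dist_bound(1)[OF ne ne' 1 2] .
    show "hausdorff_dist (X n) ((*) c ` K) \<le> e n"
      using hausdorff_dist_bound(2)[OF ne ne' 1 2] .
  qed
  have e: "e \<longlonglongrightarrow> 0"
  proof -
    have "(\<lambda>n. inverse (norm \<rho>) ^ n) \<longlonglongrightarrow> 0"
      using \<rho> by (intro LIMSEQ_power_zero) (simp add: inverse_less_1_iff)
    then show ?thesis
      unfolding e_def by (rule tendsto_mult_right_zero)
  qed
  have lower: "eventually (\<lambda>n. 0 \<le> hausdorff_dist (X n) ((*) c ` K)) sequentially"
    using b by eventually_elim (rule X)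
  have upper: "eventually (\<lambda>n. hausdorff_dist (X n) ((*) c ` K) \<le> e n) sequentially"
    using b by eventually_elim (rule X)
  have "(\<lambda>n. hausdorff_dist (X n) ((*) c ` K)) \<longlonglongrightarrow> 0"
    by (rule tendsto_sandwich[OF lower upper tendsto_const e])
  moreover have "eventually (\<lambda>n. X n \<in> compacts) sequentially"
    using b by eventually_elim (rule X)
  ultimately show ?thesis
    unfolding hausdorff_lim_def X_def using cK by blast
qed

section \<open>Signed Thue-Morse sums\<close>

definition thue_morse_sum :: "complex \<Rightarrow> nat \<Rightarrow> complex" where
  "thue_morse_sum w n = (\<Sum>i<n. (-1) ^ thue_morse 2 i * w ^ i)"

lemma thue_morse_2_cases: "thue_morse 2 n = 0 \<or> thue_morse 2 n = 1"
  using thue_morse_less[of 2 n] by auto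

lemma thue_morse_2_double:
  "thue_morse 2 (2 * n) = thue_morse 2 n" "thue_morse 2 (Suc (2 * n)) = 1 - thue_morse 2 n"
  using thue_morse_2_cases[of n] thue_morse_rec[of 2 0 n] thue_morse_rec[of 2 1 n] by auto

text \<open>The terms at \<open>2 * i\<close> and \<open>2 * i + 1\<close> carry opposite signs, so
  each pair contributes a factor \<open>1 - w\<close>.\<close>

lemma thue_morse_sum_double: "thue_morse_sum w (2 * n) = (1 - w) * thue_morse_sum (w\<^sup>2) n"
proof (induction n)
  case (Suc n)
  have "thue_morse_sum w (2 * Suc n) = thue_morse_sum w (2 * n)
      + (-1) ^ thue_morse 2 n * w ^ (2 * n) + (-1) ^ (1 - thue_morse 2 n) * w ^ (2 * n + 1)"
    by (simp add: thue_morse_sum_def thue_morse_2_double)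
  also have "\<dots> = (1 - w) * thue_morse_sum (w\<^sup>2) n + (1 - w) * (-1) ^ thue_morse 2 n * w ^ (2 * n)"
    using thue_morse_2_cases[of n] Suc by (auto simp: algebra_simps)
  also have "\<dots> = (1 - w) * thue_morse_sum (w\<^sup>2) (Suc n)"
    by (simp add: thue_morse_sum_def algebra_simps power_mult power2_eq_square power_mult_distrib)
  finally show ?case .
qed (simp add: thue_morse_sum_def)

text \<open>Each doubling squares the base. For \<open>n = 1\<close> the last factor is 1, which
  leaves the classical product formula for the signed Thue-Morse polynomial.\<close>

lemma thue_morse_sum_power2:
  "thue_morse_sum w (2 ^ m * n) = (\<Prod>j<m. 1 - w ^ 2 ^ j) * thue_morse_sum (w ^ 2 ^ m) n"
proof (induction m arbitrary: n)
  case (Suc m)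
  have "thue_morse_sum w (2 ^ Suc m * n) = thue_morse_sum w (2 ^ m * (2 * n))"
    by (simp add: algebra_simps)
  also have "\<dots> = (\<Prod>j<m. 1 - w ^ 2 ^ j) * thue_morse_sum (w ^ 2 ^ m) (2 * n)"
    by (rule Suc)
  also have "\<dots> = (\<Prod>j<Suc m. 1 - w ^ 2 ^ j) * thue_morse_sum ((w ^ 2 ^ m)\<^sup>2) n"
    by (simp add: thue_morse_sum_double)
  also have "(w ^ 2 ^ m)\<^sup>2 = w ^ 2 ^ Suc m"
    by (simp add: power_mult [symmetric] mult.commute)
  finally show ?case .
qed simp

lemma thue_morse_sum_1: "thue_morse_sum w 1 = 1"
  by (simp add: thue_morse_sum_def thue_morse_0)

text \<open>When the base returns to \<open>w\<close> after \<open>m\<close> squarings, the product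
  in front is itself the sum at \<open>2 ^ m\<close>. This is the source of exact
  self-similarity.\<close>

lemma thue_morse_sum_block:
  assumes "w ^ 2 ^ m = w"
  shows "thue_morse_sum w (2 ^ m * n) = thue_morse_sum w (2 ^ m) * thue_morse_sum w n"
  using thue_morse_sum_power2[of w m n] thue_morse_sum_power2[of w m 1] assms
  by (simp add: thue_morse_sum_1 [simplified])

lemma dist_iterate_bound:
  fixes f :: "nat \<Rightarrow> complex"
  assumes "\<And>i. dist (f i) (f (Suc i)) \<le> D"
  shows "dist (f i) (f (i + n)) \<le> of_nat n * D"
proof (induction n)
  case (Suc n)
  have "dist (f i) (f (i + Suc n)) \<le> dist (f i) (f (i + n)) + dist (f (i + n)) (f (Suc (i + n)))"
    using dist_triangle by simp
  also have "\<dots> \<le> of_nat n * D + D"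
    using Suc assms by (rule add_mono)
  finally show ?case
    by (simp add: algebra_simps)
qed simp

text \<open>Rounding an index down to a multiple of \<open>M\<close> skips fewer than
  \<open>M\<close> steps.\<close>

lemma dist_block_start:
  fixes f :: "nat \<Rightarrow> complex"
  assumes "\<And>i. dist (f i) (f (Suc i)) \<le> D" and "0 < M"
  shows "dist (f i) (f (M * (i div M))) \<le> of_nat M * D"
proof -
  have "0 \<le> D"
    using assms(1)[of 0] zero_le_dist order_trans by blast
  have "dist (f (M * (i div M))) (f (M * (i div M) + i mod M)) \<le> of_nat (i mod M) * D"
    using assms(1) by (rule dist_iterate_bound)
  also have "\<dots> \<le> of_nat M * D"
    using \<open>0 \<le> D\<close> \<open>0 < M\<close> by (intro mult_right_mono) (auto simp: less_imp_le)
  finally show ?thesis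
    by (simp add: dist_commute)
qed

section \<open>Limits of self-similar curves\<close>

text \<open>The uniform \<open>C\<close> comes from truncating base-\<open>Q\<close> digits of an
  index: each dropped digit costs a bounded amount, and after rescaling these costs are dominated by
  a convergent geometric series.\<close>

lemma self_similar_limit:
  fixes f :: "nat \<Rightarrow> complex"
  assumes r: "norm r > 1" and Q: "0 < Q" and self: "\<And>n. f (Q * n) = r * f n"
    and D: "\<And>i. dist (f i) (f (Suc i)) \<le> D"
  obtains K C where "K \<in> compacts"
    "\<And>n i. i < Q ^ n \<Longrightarrow> inverse r ^ n * f i \<in> K"
    "\<And>n y. y \<in> K \<Longrightarrow> \<exists>i<Q ^ n. dist (f i) (r ^ n * y) \<le> C"
proof -
  define K where "K = closure (\<Union>n. (\<lambda>i. inverse r ^ n * f i) ` {..<Q ^ n})"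
  \<comment> \<open>Chosen so that \<open>c * (norm r ^ k - 1)\<close> solves the error recursion
    \<open>e (k + 1) = Q * D + norm r * e k\<close> with \<open>e 0 = 0\<close>.\<close>
  define c where "c = of_nat Q * D / (norm r - 1)"
  have r0: "r \<noteq> 0"
    using r by auto
  have "0 \<le> D"
    using D[of 0] zero_le_dist order_trans by blast
  then have c0: "0 \<le> c"
    using r by (simp add: c_def)
  have c: "of_nat Q * D = c * (norm r - 1)"
    using r by (simp add: c_def)
  have self_pow: "f (Q ^ k * n) = r ^ k * f n" for k n
  proof (induction k arbitrary: n)
    case (Suc k)
    have "f (Q ^ Suc k * n) = f (Q ^ k * (Q * n))"
      by (simp add: algebra_simps)
    then show ?case
      by (simp add: Suc self)
  qed simp
  \<comment> \<open>Compares \<open>i\<close> with its leading base-\<open>Q\<close> digits. The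
    induction strips the last digit first and then applies the hypothesis to
    \<open>i div Q\<close>.\<close>
  have block: "dist (f i) (r ^ k * f (i div Q ^ k)) \<le> c * (norm r ^ k - 1)" for k i
  proof (induction k arbitrary: i)
    case (Suc k)
    have "dist (r * f (i div Q)) (r * (r ^ k * f (i div Q div Q ^ k)))
        = norm r * dist (f (i div Q)) (r ^ k * f (i div Q div Q ^ k))"
      by (simp add: dist_norm norm_mult flip: right_diff_distrib)
    also have "\<dots> \<le> norm r * (c * (norm r ^ k - 1))"
      by (intro mult_left_mono Suc) simp
    moreover have "dist (f i) (r * f (i div Q)) \<le> c * (norm r - 1)"
      using dist_block_start[of f D Q i] D Q by (simp add: self c)
    ultimately have "dist (f i) (r * (r ^ k * f (i div Q div Q ^ k)))
        \<le> c * (norm r - 1) + norm r * (c * (norm r ^ k - 1))"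
      using dist_triangle[of "f i" "r * (r ^ k * f (i div Q div Q ^ k))" "r * f (i div Q)"]
      by linarith
    then show ?case
      by (simp add: algebra_simps div_mult2_eq)
  qed simp
  have dense0: "\<exists>i<Q ^ n. dist (f i) (r ^ n * (inverse r ^ m * f j)) \<le> c"
    if j: "j < Q ^ m" for n m j
  proof (cases "m \<le> n")
    \<comment> \<open>A point of an earlier generation is already a vertex after magnification, so
      the distance is 0.\<close>
    case True
    then have "r ^ n * (inverse r ^ m * f j) = f (Q ^ (n - m) * j)"
      using r0 by (simp add: self_pow power_diff power_inverse divide_simps)
    moreover have "Q ^ (n - m) * j < Q ^ n"
    proof -
      have "Q ^ (n - m) * j < Q ^ (n - m) * Q ^ m"
        using j Q by simp
      then show ?thesis
        using True by (simp flip: power_add)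
    qed
    ultimately show ?thesis
      using c0 by (intro exI[of _ "Q ^ (n - m) * j"]) simp
  next
    \<comment> \<open>For a later generation, drop the last \<open>m - n\<close> digits of
      \<open>j\<close>. The error \<open>c * (norm r ^ k - 1)\<close> divided by
      \<open>norm r ^ k\<close> stays below \<open>c\<close>, however large \<open>k\<close>
      is.\<close>
    case False
    define k where "k = m - n"
    have m: "m = n + k"
      using False by (simp add: k_def)
    have eq: "r ^ n * (inverse r ^ m * f j) = inverse r ^ k * f j"
      using r0 by (simp add: m power_add power_inverse)
    have "f (j div Q ^ k) - inverse r ^ k * f j = inverse r ^ k * (r ^ k * f (j div Q ^ k) - f j)"
      using r0 by (simp add: power_inverse algebra_simps)
    then have "dist (f (j div Q ^ k)) (inverse r ^ k * f j)
        = inverse (norm r ^ k) * dist (f j) (r ^ k * f (j div Q ^ k))"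
      by (simp add: dist_norm norm_mult norm_power norm_inverse norm_minus_commute power_inverse)
    also have "\<dots> \<le> inverse (norm r ^ k) * (c * (norm r ^ k - 1))"
      by (intro mult_left_mono block) simp
    also have "\<dots> = c * (1 - inverse (norm r ^ k))"
      using r0 by (simp add: field_simps)
    also have "\<dots> \<le> c * 1"
      using c0 by (intro mult_left_mono) auto
    finally have "dist (f (j div Q ^ k)) (r ^ n * (inverse r ^ m * f j)) \<le> c"
      by (simp add: eq)
    moreover have "j div Q ^ k < Q ^ n"
      using j Q by (simp add: m power_add less_mult_imp_div_less)
    ultimately show ?thesis
      by blast
  qed
  have dense: "\<exists>i<Q ^ n. dist (f i) (r ^ n * y) \<le> c + 1" if "y \<in> K" for n y
  proof -
    \<comment> \<open>Approximating to precision \<open>inverse (norm r ^ n)\<close> ensures that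
      passing to the closure costs at most 1 after magnification by \<open>r ^ n\<close>.\<close>
    have "0 < inverse (norm r ^ n)"
      using r0 by simp
    with that[unfolded K_def closure_approachable, rule_format, of "inverse (norm r ^ n)"]
    have "\<exists>x\<in>(\<Union>n. (\<lambda>i. inverse r ^ n * f i) ` {..<Q ^ n}). dist x y < inverse (norm r ^ n)" .
    then obtain x where x: "x \<in> (\<Union>n. (\<lambda>i. inverse r ^ n * f i) ` {..<Q ^ n})"
        "dist x y < inverse (norm r ^ n)" ..
    have "dist (r ^ n * x) (r ^ n * y) = norm r ^ n * dist x y"
      by (simp add: dist_norm norm_mult norm_power flip: right_diff_distrib)
    also have "\<dots> \<le> norm r ^ n * inverse (norm r ^ n)"
      using x(2) by (intro mult_left_mono) auto
    also have "\<dots> = 1"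
      using r0 by simp
    finally have xy: "dist (r ^ n * x) (r ^ n * y) \<le> 1" .
    obtain i where i: "i < Q ^ n" "dist (f i) (r ^ n * x) \<le> c"
      using x(1) dense0 by blast
    then have "dist (f i) (r ^ n * y) \<le> c + 1"
      using xy dist_triangle[of "f i" "r ^ n * y" "r ^ n * x"] by linarith
    then show ?thesis
      using i(1) by blast
  qed
  have mem: "inverse r ^ n * f i \<in> K" if "i < Q ^ n" for n i
    unfolding K_def using that by (intro subsetD[OF closure_subset]) blast
  \<comment> \<open>At \<open>n = 0\<close> the only available index is 0, so the density estimate
    is a bound on \<open>K\<close>.\<close>
  have "K \<subseteq> cball (f 0) (c + 1)"
    using dense[of _ 0] by auto
  then have "bounded K"
    using bounded_cball bounded_subset by blast
  moreover have "closed K"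
    by (simp add: K_def)
  ultimately have "K \<in> compacts"
    using mem[of 0 0] unfolding compacts_def compact_eq_bounded_closed by auto
  then show ?thesis
    using mem dense by (rule that)
qed

section \<open>The two curves\<close>

lemma turtle_pos_simps [simp]:
  "turtle_pos 0 = 0" "turtle_pos (a + b) = turtle_pos a + turtle_dir a * turtle_pos b"
  "turtle_pos (turtle_of_complex z) = z"
  by (transfer; auto)+

lemma turtle_dir_simps [simp]:
  "turtle_dir 0 = 1" "turtle_dir (a + b) = turtle_dir a * turtle_dir b"
  "turtle_dir (turtle_of_complex z) = 1" "norm (turtle_dir a) = 1"
  by (transfer; auto)+

text \<open>The accumulated heading has modulus 1, so the length of a step depends only on its
  letter.\<close>

lemma dist_turtle_point_Suc:
  "dist (turtle_point T i) (turtle_point T (Suc i)) = norm (turtle_pos (snd T (fst T i)))"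
  by (simp add: turtle_point_def dist_norm norm_mult)

lemma absolute_walk:
  "turtle_dir (\<Sum>i\<leftarrow>xs. turtle_of_complex (g i)) = 1"
  "turtle_pos (\<Sum>i\<leftarrow>xs. turtle_of_complex (g i)) = (\<Sum>i\<leftarrow>xs. g i)"
  by (induction xs) auto

section \<open>Roots of unity\<close>

lemma root_of_unity_power_self: "0 < q \<Longrightarrow> root_of_unity q ^ q = 1"
  by (simp add: root_of_unity_def exp_of_nat_mult [symmetric])

lemma root_of_unity_nonzero [simp]: "root_of_unity q \<noteq> 0"
  by (simp add: root_of_unity_def)

lemma norm_root_of_unity [simp]: "norm (root_of_unity q) = 1"
  by (simp add: root_of_unity_def)

lemma root_of_unity_2: "root_of_unity 2 = - 1"
  by (simp add: root_of_unity_def exp_Euler)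

lemma root_of_unity_mult_power:
  assumes "0 < m"
  shows "root_of_unity (m * q) ^ m = root_of_unity q"
  using assms by (simp add: root_of_unity_def exp_of_nat_mult [symmetric])

lemma root_of_unity_power_eq_1_iff:
  assumes "0 < q"
  shows "root_of_unity q ^ n = 1 \<longleftrightarrow> q dvd n"
proof -
  have "root_of_unity q ^ n = exp (2 * of_real pi * \<i> * of_nat n / of_nat q)"
    by (simp add: root_of_unity_def exp_of_nat_mult [symmetric] mult_ac)
  then show ?thesis
    using assms complex_root_unity_eq_1[of q n] by simp
qed

lemma root_of_unity_powi_cong:
  assumes "0 < q" "[a = b] (mod int q)"
  shows "root_of_unity q powi a = root_of_unity q powi b"
proof -
  obtain k where "a = b + int q * k"
    using assms(2) by (metis cong_iff_lin cong_sym)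
  then show ?thesis
    using assms(1) by (simp add: power_int_add power_int_mult root_of_unity_power_self)
qed

section \<open>Dekking curves with \<open>p = 2\<close> as signed Thue-Morse sums\<close>

lemma dekking_step:
  assumes "0 < q"
  shows "snd (dekking 2 q k) (x, n mod q) = turtle_of_complex ((-1) ^ x * (root_of_unity q powi k) ^ n)"
proof -
  \<comment> \<open>Exponents of a \<open>q\<close>-th root of unity matter only modulo
    \<open>q\<close>, so the residue may be replaced by \<open>n\<close> itself.\<close>
  have "[k * int (n mod q) = k * int n] (mod int q)"
    by (intro cong_mult) (auto simp: cong_def zmod_int)
  then have "root_of_unity q powi (k * int (n mod q)) = (root_of_unity q powi k) ^ n"
    using root_of_unity_powi_cong[OF assms] by (metis power_int_mult power_int_of_nat)
  then show ?thesis
    by (simp add: dekking_def root_of_unity_2)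
qed

lemma turtle_point_dekking:
  assumes "0 < q"
  shows "turtle_point (dekking 2 q k) n = thue_morse_sum (root_of_unity q powi k) n"
proof -
  have "fst (dekking 2 q k) i = (thue_morse 2 i, i mod q)" for i
    by (simp add: dekking_def)
  then show ?thesis
    using assms by (simp add: turtle_point_def dekking_step absolute_walk thue_morse_sum_def
        interv_sum_list_conv_sum_set_nat atLeast0LessThan)
qed

text \<open>The letter at \<open>n\<close> expands to the letters at \<open>2 * n\<close> and
  \<open>2 * n + 1\<close>, so the Thue-Morse sequence is a fixed point of the morphism.\<close>

lemma phi_morphism_2_thue_morse:
  "phi_morphism 2 (map (thue_morse 2) [0..<n]) = map (thue_morse 2) [0..<2 * n]"
proof (induction n)
  case (Suc n)
  have "phi_morphism 2 (map (thue_morse 2) [0..<Suc n])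
      = phi_morphism 2 (map (thue_morse 2) [0..<n]) @ phi_morphism 2 [thue_morse 2 n]"
    by (simp add: phi_morphism_def morphism_def)
  then show ?case
    using thue_morse_2_cases[of n]
    by (auto simp: Suc thue_morse_2_double phi_morphism_2 phi_morphism_2 [simplified])
qed (simp add: phi_morphism_def morphism_def)

lemma phi_morphism_2_pow:
  "(phi_morphism 2 ^^ m) [0] = map (thue_morse 2) [0..<2 ^ m]"
  by (induction m) (simp_all add: phi_morphism_2_thue_morse thue_morse_0)

text \<open>The block \<open>\<lambda>((0,0))\<close> consists of the first
  \<open>2 ^ totient q\<close> letters of the Dekking sequence, so the scaling factor is a point of
  the curve.\<close>

lemma scaling_factor_2:
  assumes "0 < q"
  shows "scaling_factor 2 q k = thue_morse_sum (root_of_unity q powi k) (2 ^ totient q)"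
proof -
  have "lambda_morphism 2 q [(0, 0)] = map (\<lambda>j. (thue_morse 2 j, j mod q)) [0..<2 ^ totient q]"
    by (simp add: lambda_morphism_def morphism_def mu_morphism_def delta_morphism_def shift_word_def
        phi_morphism_2_pow block_len_def)
  then show ?thesis
    using assms by (simp add: scaling_factor_def word_pos_def word_sum_def comp_def dekking_step
        absolute_walk thue_morse_sum_def interv_sum_list_conv_sum_set_nat atLeast0LessThan)
qed

text \<open>The words 01 and 10 turn by the same \<open>\<alpha>\<close> because headings commute.
  With \<open>A\<close> the mean and \<open>B\<close> half the difference of their displacements,
  pair \<open>i\<close> moves by \<open>A + B\<close> or \<open>A - B\<close> according to its
  Thue-Morse sign, rotated by \<open>\<alpha> ^ i\<close>.\<close>

lemma thue_morse_walk_double: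
  fixes \<tau> :: "nat \<Rightarrow> turtle"
  defines "T \<equiv> (thue_morse 2, \<tau>)"
  defines "\<alpha> \<equiv> word_dir T [0, 1]"
  defines "A \<equiv> (word_pos T [0, 1] + word_pos T [1, 0]) / 2"
  defines "B \<equiv> (word_pos T [0, 1] - word_pos T [1, 0]) / 2"
  shows "turtle_point T (2 * n) = A * (\<Sum>i<n. \<alpha> ^ i) + B * thue_morse_sum \<alpha> n"
proof -
  define S where "S n = (\<Sum>i\<leftarrow>[0..<n]. snd T (fst T i))" for n
  have \<alpha>: "turtle_dir (\<tau> 0) * turtle_dir (\<tau> (Suc 0)) = \<alpha>"
    by (simp add: \<alpha>_def T_def word_dir_def word_sum_def)
  have "turtle_dir (S (2 * n)) = \<alpha> ^ n \<and>
      turtle_pos (S (2 * n)) = A * (\<Sum>i<n. \<alpha> ^ i) + B * thue_morse_sum \<alpha> n"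
  proof (induction n)
    case (Suc n)
    have S: "S (2 * Suc n) = S (2 * n) + (\<tau> (thue_morse 2 n) + \<tau> (1 - thue_morse 2 n))"
      by (simp add: S_def T_def thue_morse_2_double add.assoc)
    have p: "turtle_pos (\<tau> (thue_morse 2 n) + \<tau> (1 - thue_morse 2 n)) = A + (-1) ^ thue_morse 2 n * B"
      using thue_morse_2_cases[of n]
      by (auto simp: A_def B_def T_def word_pos_def word_sum_def field_simps)
    have d: "turtle_dir (\<tau> (thue_morse 2 n) + \<tau> (1 - thue_morse 2 n)) = \<alpha>"
      using thue_morse_2_cases[of n] \<alpha> by (auto simp: mult.commute)
    have "turtle_pos (S (2 * Suc n))
        = turtle_pos (S (2 * n)) + turtle_dir (S (2 * n)) * (A + (-1) ^ thue_morse 2 n * B)"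
      unfolding S turtle_pos_simps(2)[of "S (2 * n)"] p ..
    moreover have "turtle_dir (S (2 * Suc n)) = turtle_dir (S (2 * n)) * \<alpha>"
      unfolding S turtle_dir_simps(2)[of "S (2 * n)"] d ..
    ultimately show ?case
      using Suc by (simp add: thue_morse_sum_def algebra_simps)
  qed (simp add: S_def thue_morse_sum_def)
  then show ?thesis
    by (simp add: turtle_point_def S_def)
qed

lemma norm_geometric_sum_le:
  fixes a :: complex
  assumes "norm a = 1" "a \<noteq> 1"
  shows "norm (\<Sum>i<n. a ^ i) \<le> 2 / norm (a - 1)"
proof -
  have "norm (a ^ n - 1) \<le> norm (a ^ n) + norm (1 :: complex)"
    by (rule norm_triangle_ineq4)
  also have "\<dots> = 2"
    using assms(1) by (simp add: norm_power)
  finally show ?thesis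
    using assms(2) by (simp add: geometric_sum norm_divide divide_right_mono)
qed

theorem theorem6:
  fixes q b k\<^sub>2 :: nat and k\<^sub>1 :: int and \<tau> :: "nat \<Rightarrow> turtle"
  defines "R \<equiv> dekking 2 q k\<^sub>1"
    and "T \<equiv> (thue_morse 2, \<tau>)"
    and "r \<equiv> scaling_factor 2 q k\<^sub>1"
    and "Q \<equiv> 2 ^ totient q"
  assumes "q \<ge> 2" and "odd q"
    and "coprime k\<^sub>1 (int q)"
    and "dekking_regular 2 q k\<^sub>1"
    and "coprime k\<^sub>2 q"
    and "word_dir T (phi_morphism 2 [0]) = root_of_unity (2 ^ b * q) ^ k\<^sub>2"
    and "word_pos T (phi_morphism 2 [0]) \<noteq> word_pos T (phi_morphism 2 [1])"
    and "\<exists>d :: nat. [k\<^sub>1 = 2 ^ d * int k\<^sub>2] (mod (int q))"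
  shows "\<exists>K. K \<in> compacts \<and> K \<noteq> {0} \<and> limit_curve R K \<and> limit_curve T K \<and>
           hausdorff_lim (\<lambda>n. (*) (inverse r ^ n) ` polyline (turtle_prefix R (Q ^ n))) K"
proof -

  \<comment> \<open>Self-similarity of \<open>R\<close> and construction of the common limit\<close>
  have q: "0 < q"
    using \<open>q \<ge> 2\<close> by simp
  have "coprime 2 q"
    using \<open>odd q\<close> by simp
  then have "[int Q = 1] (mod int q)"
    using euler_theorem[of 2 q] cong_int_iff[of Q 1 q] by (simp add: Q_def)
  have Q2: "2 \<le> Q"
  proof -
    have "(2::nat) ^ 1 \<le> 2 ^ totient q"
      using q by (intro power_increasing) (auto simp: Suc_le_eq)
    then show ?thesis
      by (simp add: Q_def)
  qed
  define w where "w = root_of_unity q powi k\<^sub>1"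
  define f where "f = thue_morse_sum w"
  have norm_w: "norm w = 1"
    by (simp add: w_def norm_power_int)
  have "w ^ Q = root_of_unity q powi (k\<^sub>1 * int Q)"
    by (simp add: w_def power_int_mult)
  also have "\<dots> = w"
    unfolding w_def using cong_scalar_left[OF \<open>[int Q = 1] (mod int q)\<close>, of k\<^sub>1]
    by (intro root_of_unity_powi_cong q) simp
  finally have wQ: "w ^ Q = w" .
  have R: "turtle_point R = f"
    using turtle_point_dekking[OF q] by (auto simp: R_def f_def w_def)
  have "r = f Q"
    using scaling_factor_2[OF q] by (simp add: r_def f_def w_def Q_def)
  then have self: "f (Q * n) = r * f n" for n
    using thue_morse_sum_block[OF wQ[unfolded Q_def]] by (simp add: f_def Q_def)
  have r: "norm r > 1"
    using \<open>dekking_regular 2 q k\<^sub>1\<close> by (simp add: dekking_regular_def r_def)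
  then have r0: "r \<noteq> 0"
    by auto
  have step: "dist (f i) (f (Suc i)) \<le> 1" for i
    by (simp add: f_def thue_morse_sum_def dist_norm norm_mult norm_power norm_w)
  obtain K C where K: "K \<in> compacts"
    and mem: "\<And>n i. i < Q ^ n \<Longrightarrow> inverse r ^ n * f i \<in> K"
    and dense: "\<And>n y. y \<in> K \<Longrightarrow> \<exists>i<Q ^ n. dist (f i) (r ^ n * y) \<le> C"
    using self_similar_limit[of r Q f 1] r Q2 self step by auto
  have C: "0 \<le> C"
    using dense[of _ 0] K zero_le_dist order_trans unfolding compacts_def by blast
  have unscale: "z * r ^ n * (inverse r ^ n * x) = z * x" for z x n
    using r0 by (simp add: power_inverse)

  \<comment> \<open>The vertex \<open>f 1 = 1\<close>, rescaled at level 1, is a nonzero point of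
    \<open>K\<close>.\<close>
  have "inverse r \<in> K"
    using mem[of 1 1] Q2 by (simp add: f_def thue_morse_sum_1 [simplified])
  then have "K \<noteq> {0}"
    using r0 by auto
  \<comment> \<open>Only eventually: at \<open>n = 0\<close> there is one vertex and the polyline is
    empty.\<close>
  have Qn: "eventually (\<lambda>n. 2 \<le> Q ^ n) sequentially"
  proof (intro eventually_sequentiallyI)
    fix n :: nat
    assume "1 \<le> n"
    then have "Q ^ 1 \<le> Q ^ n"
      using Q2 by (intro power_increasing) auto
    then show "2 \<le> Q ^ n"
      using Q2 by simp
  qed
  have "hausdorff_lim (\<lambda>n. (*) (inverse r ^ n) ` polyline (map f [0..<Q ^ n])) ((*) 1 ` K)"
  proof (rule hausdorff_lim_rescaled_polyline[OF K r, where f = f and D = 1 and C = C, OF Qn step])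
    show "\<exists>y\<in>K. dist (f i) (1 * r ^ n * y) \<le> C" if "i < Q ^ n" for n i
    proof
      show "inverse r ^ n * f i \<in> K"
        using that by (rule mem)
      show "dist (f i) (1 * r ^ n * (inverse r ^ n * f i)) \<le> C"
        unfolding unscale using C by simp
    qed
    show "\<exists>i<Q ^ n. dist (f i) (1 * r ^ n * y) \<le> C" if "y \<in> K" for n y
      using dense[OF that] by simp
  qed
  then have limR:
    "hausdorff_lim (\<lambda>n. (*) (inverse r ^ n) ` polyline (turtle_prefix R (Q ^ n))) ((*) 1 ` K)"
    by (simp add: turtle_prefix_def R)
  then have "limit_curve R K"
    unfolding limit_curve_def using K r r0
    by (intro conjI exI[of _ r] exI[of _ 1] exI[of _ "\<lambda>n. Q ^ n"]) auto

  \<comment> \<open>Comparison of \<open>T\<close> with \<open>R\<close>\<close>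
  define \<alpha> where "\<alpha> = word_dir T [0, 1]"
  define A where "A = (word_pos T [0, 1] + word_pos T [1, 0]) / 2"
  define B where "B = (word_pos T [0, 1] - word_pos T [1, 0]) / 2"
  define g where "g = turtle_point T"
  have "B \<noteq> 0"
    using \<open>word_pos T (phi_morphism 2 [0]) \<noteq> word_pos T (phi_morphism 2 [1])\<close>
    unfolding phi_morphism_2 by (simp add: B_def)
  have double: "g (2 * n) = A * (\<Sum>i<n. \<alpha> ^ i) + B * thue_morse_sum \<alpha> n" for n
    using thue_morse_walk_double[of \<tau> n] by (simp add: A_def B_def \<alpha>_def g_def T_def)
  have norm_\<alpha>: "norm \<alpha> = 1"
    by (simp add: \<alpha>_def word_dir_def)
  have "\<alpha> ^ 2 ^ b = (root_of_unity (2 ^ b * q) ^ 2 ^ b) ^ k\<^sub>2"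
    using \<open>word_dir T (phi_morphism 2 [0]) = _\<close>
    unfolding phi_morphism_2 by (simp add: \<alpha>_def mult.commute flip: power_mult)
  then have \<alpha>b: "\<alpha> ^ 2 ^ b = root_of_unity q ^ k\<^sub>2"
    by (simp add: root_of_unity_mult_power)
  have \<alpha>j: "\<alpha> ^ 2 ^ (b + j) = root_of_unity q ^ (k\<^sub>2 * 2 ^ j)" for j
  proof -
    have "\<alpha> ^ 2 ^ (b + j) = (\<alpha> ^ 2 ^ b) ^ 2 ^ j"
      by (simp add: power_add power_mult)
    then show ?thesis
      by (simp add: \<alpha>b power_mult)
  qed
  \<comment> \<open>Otherwise \<open>b\<close> more squarings would make a power of
    \<open>root_of_unity q\<close> with exponent coprime to \<open>q\<close> equal to 1. The case
    \<open>j = 0\<close> bounds the geometric sum; the other cases help keep \<open>c\<close>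
    nonzero.\<close>
  have \<alpha>1: "\<alpha> ^ 2 ^ j \<noteq> 1" for j
  proof
    assume "\<alpha> ^ 2 ^ j = 1"
    then have "\<alpha> ^ 2 ^ (b + j) = 1"
      by (metis add.commute power_add power_mult power_one)
    then have "q dvd k\<^sub>2 * 2 ^ j"
      using \<alpha>j root_of_unity_power_eq_1_iff[OF q] by simp
    moreover have "coprime q (k\<^sub>2 * 2 ^ j)"
      using \<open>coprime k\<^sub>2 q\<close> \<open>coprime 2 q\<close> by (simp add: coprime_commute)
    ultimately have "is_unit q"
      by (metis coprime_absorb_left)
    then show False
      using \<open>q \<ge> 2\<close> by simp
  qed
  obtain d :: nat where d: "[k\<^sub>1 = 2 ^ d * int k\<^sub>2] (mod (int q))"
    using \<open>\<exists>d. _\<close> by blast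
  define m where "m = b + d"
  have "root_of_unity q ^ (k\<^sub>2 * 2 ^ d) = root_of_unity q powi int (k\<^sub>2 * 2 ^ d)"
    by (rule power_int_of_nat [symmetric])
  also have "int (k\<^sub>2 * 2 ^ d) = 2 ^ d * int k\<^sub>2"
    by simp
  also have "root_of_unity q powi (2 ^ d * int k\<^sub>2) = w"
    unfolding w_def using d by (intro root_of_unity_powi_cong q) (rule cong_sym)
  finally have \<alpha>m: "\<alpha> ^ 2 ^ m = w"
    by (simp add: \<alpha>j m_def)
  define c where "c = B * (\<Prod>j<m. 1 - \<alpha> ^ 2 ^ j)"
  have "c \<noteq> 0"
    using \<open>B \<noteq> 0\<close> \<alpha>1 by (simp add: c_def)
  \<comment> \<open>\<open>m\<close> squarings take \<alpha> to \<open>w\<close>; the extra doubling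
    comes from reading letters of \<open>T\<close> in pairs.\<close>
  define M where "M = (2::nat) ^ Suc m"
  have M: "0 < M"
    by (simp add: M_def)
  define E1 where "E1 = norm A * (2 / norm (\<alpha> - 1))"
  have gM: "dist (g (M * n)) (c * f n) \<le> E1" for n
  proof -
    have "g (M * n) = g (2 * (2 ^ m * n))"
      by (simp add: M_def mult.assoc)
    also have "\<dots> = A * (\<Sum>i<2 ^ m * n. \<alpha> ^ i) + c * f n"
      by (simp add: double thue_morse_sum_power2 \<alpha>m c_def f_def)
    finally have "dist (g (M * n)) (c * f n) = norm A * norm (\<Sum>i<2 ^ m * n. \<alpha> ^ i)"
      by (simp add: dist_norm norm_mult)
    then show ?thesis
      unfolding E1_def using norm_geometric_sum_le[OF norm_\<alpha>] \<alpha>1[of 0]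
      by (auto intro!: mult_left_mono simp del: times_divide_eq_right)
  qed
  define D where "D = max (norm (turtle_pos (\<tau> 0))) (norm (turtle_pos (\<tau> 1)))"
  have stepT: "dist (g i) (g (Suc i)) \<le> D" for i
    using thue_morse_2_cases[of i] by (auto simp: g_def dist_turtle_point_Suc D_def T_def)
  \<comment> \<open>First the cost of rounding the index to a multiple of \<open>M\<close>, then
    that of the geometric sum.\<close>
  define E where "E = of_nat M * D + E1"
  have near: "dist (g i) (c * f (i div M)) \<le> E" for i
    using dist_block_start[of g D M i] stepT M gM[of "i div M"]
      dist_triangle[of "g i" "c * f (i div M)" "g (M * (i div M))"] by (simp add: E_def)
  \<comment> \<open>With length \<open>M * Q ^ n\<close> the block indices \<open>i div M\<close>
    run exactly through the indices below \<open>Q ^ n\<close> used for \<open>R\<close>.\<close>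
  have "hausdorff_lim (\<lambda>n. (*) (inverse r ^ n) ` polyline (map g [0..<M * Q ^ n])) ((*) c ` K)"
  proof (rule hausdorff_lim_rescaled_polyline[OF K r, where f = g and D = D, OF _ stepT,
        where C = "E + norm c * C"])
    show "eventually (\<lambda>n. 2 \<le> M * Q ^ n) sequentially"
      using Qn
    proof eventually_elim
      case (elim n)
      have "1 * Q ^ n \<le> M * Q ^ n"
        using M by (intro mult_right_mono) auto
      then show ?case
        using elim by linarith
    qed
    show "\<exists>y\<in>K. dist (g i) (c * r ^ n * y) \<le> E + norm c * C" if "i < M * Q ^ n" for n i
    proof
      show "inverse r ^ n * f (i div M) \<in> K"
        using that by (intro mem) (simp add: less_mult_imp_div_less mult.commute)
      show "dist (g i) (c * r ^ n * (inverse r ^ n * f (i div M))) \<le> E + norm c * C"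
        unfolding unscale using near[of i] C by (simp add: add_increasing2)
    qed
    show "\<exists>i<M * Q ^ n. dist (g i) (c * r ^ n * y) \<le> E + norm c * C" if "y \<in> K" for n y
    proof -
      obtain i where i: "i < Q ^ n" "dist (f i) (r ^ n * y) \<le> C"
        using dense[OF \<open>y \<in> K\<close>] by blast
      have "dist (c * f i) (c * r ^ n * y) = norm c * dist (f i) (r ^ n * y)"
        by (simp add: dist_norm mult.assoc flip: norm_mult right_diff_distrib)
      also have "\<dots> \<le> norm c * C"
        using i(2) by (simp add: mult_left_mono)
      finally have "dist (g (M * i)) (c * r ^ n * y) \<le> E + norm c * C"
        using near[of "M * i"] M dist_triangle[of "g (M * i)" "c * r ^ n * y" "c * f i"] by simp
      then show ?thesis
        using i(1) M by (intro exI[of _ "M * i"]) simp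
    qed
  qed
  then have "limit_curve T K"
    unfolding limit_curve_def turtle_prefix_def g_def using K r r0 \<open>c \<noteq> 0\<close>
    by (intro conjI exI[of _ r] exI[of _ c] exI[of _ "\<lambda>n. M * Q ^ n"]) auto
  then show ?thesis
    using K \<open>K \<noteq> {0}\<close> \<open>limit_curve R K\<close> limR by auto
qed

end
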